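(* If the Simple Gradient $SG$ for a neural network $f$ is $\epsilon$-uniformly stable (with respect to a training algorithm $A$ and training sets of size $n$), then its grouped version $g\text{-}SG$ is $\epsilon'$-uniformly stable for a certain $\epsilon'\le\epsilon$.
   Context: Networks are maps $f_\theta:\mathbb{R}^d\to\mathbb{R}^C$, $\theta\in\Theta$, differentiable at the inputs considered. A (possibly randomized) training algorithm $A$ maps a training set of $n$ samples and its internal randomness (drawn independently of the data) to a parameter $\hat\theta\in\Theta$. $\|\cdot\|$ is the Euclidean norm. All quantities are assumed measurable and integrable so that the expectations exist. Simple Gradient: $SG(f_\theta,\mathbf{x}):=\nabla_{\mathbf{x}}f_{\theta,c}(\mathbf{x})\in\mathbb{R}^d$, where $f_{\theta,c}$ is the $c$-th output coordinate and $c$ is the network's predicted label at $\mathbf{x}$ (the coordinate with maximum prediction score, treated as fixed when differentiating). Grouping: for each $\mathbf{x}$, the $d$ pixels (coordinates) $\{1,\dots,d\}$ are partitioned into $p$ nonempty groups $\mathbb{S}(\mathbf{x})=\{S_1(\mathbf{x}),\dots,S_p(\mathbf{x})\}$; the partition depends only on $\mathbf{x}$, not on the network. Define $\kappa(\mathbf{x})\in\mathbb{R}^{d\times d}$ by $\kappa(\mathbf{x})_{i,j}=1/|S_k|$ if $i,j$ belong to the same group $S_k$, and $\kappa(\mathbf{x})_{i,j}=0$ otherwise. The grouped Simple Gradient is $g\text{-}SG(f_\theta,\mathbf{x}):=\kappa(\mathbf{x})\,SG(f_\theta,\mathbf{x})$. Uniform stability: an interpretation method $I$ (assigning to a network $f_\theta$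 and input $\mathbf{x}$ a map $I(f_\theta,\mathbf{x})\in\mathbb{R}^d$) is $\epsilon$-uniformly stable if for every (possibly random) pair of training sets $S,S'$ of size $n$ that differ in at most one sample, with $f_{\hat\theta_1},f_{\hat\theta_2}$ the networks obtained by running $A$ on $S$ and $S'$ with the same internal randomness (independent of $(S,S')$), $$\sup_{\mathbf{x}}\ \mathbb{E}_{S,S',A}\bigl[\|I(f_{\hat\theta_1},\mathbf{x})-I(f_{\hat\theta_2},\mathbf{x})\|\bigr]\le\epsilon,$$ where the expectation is over the randomness of $S$, $S'$ and of $A$. (Deterministic pairs $S,S'$ are included.) *)

theory Defs
  imports "HOL-Probability.Probability" "HOL-Library.Disjoint_Sets"
begin

text \<open>
  A network is a map \<open>g :: real ^ 'd \<Rightarrow> real ^ 'c\<close>. Its predicted label is an output coordinate with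
  maximum score. As the maximum may be attained more than once, the label is read off the score
  vector by an arbitrary but fixed selection rule.
\<close>

definition label_rule :: "(real ^ 'c \<Rightarrow> 'c) \<Rightarrow> bool" where
  "label_rule pred \<longleftrightarrow> (\<forall>s. is_arg_max (\<lambda>i. s $ i) (\<lambda>_. True) (pred s))"

text \<open>The label is computed at \<open>x\<close>, outside the function of \<open>y\<close> that is differentiated.\<close>

definition SG ::
  "(real ^ 'c \<Rightarrow> 'c) \<Rightarrow> (real ^ 'd \<Rightarrow> real ^ 'c) \<Rightarrow> real ^ 'd \<Rightarrow> real ^ 'd" where
  "SG pred g x = (let c = pred (g x) in THE D. GDERIV (\<lambda>y. g y $ c) x :> D)"

definition kappa :: "'d set set \<Rightarrow> real ^ 'd ^ 'd" where
  "kappa G = (\<chi> i j. if \<exists>K\<in>G. i \<in> K \<and> j \<in> K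
                    then 1 / real (card (THE K. K \<in> G \<and> i \<in> K \<and> j \<in> K))
                    else 0)"

definition grouped_SG ::
  "(real ^ 'd \<Rightarrow> 'd set set) \<Rightarrow> (real ^ 'c \<Rightarrow> 'c) \<Rightarrow>
    (real ^ 'd \<Rightarrow> real ^ 'c) \<Rightarrow> real ^ 'd \<Rightarrow> real ^ 'd" where
  "grouped_SG grp pred g x = kappa (grp x) *v SG pred g x"

text \<open>Training sets are tuples of \<open>n\<close> samples from the measurable space \<open>Z\<close>; of the measure \<open>Z\<close>
  only the underlying measurable space is used.\<close>

definition training_sets :: "'z measure \<Rightarrow> nat \<Rightarrow> (nat \<Rightarrow> 'z) measure" where
  "training_sets Z n = Pi\<^sub>M {..<n} (\<lambda>_. Z)"

definition neighbouring_pairs ::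
  "'z measure \<Rightarrow> nat \<Rightarrow> ((nat \<Rightarrow> 'z) \<times> (nat \<Rightarrow> 'z)) measure" where
  "neighbouring_pairs Z n =
     restrict_space (training_sets Z n \<Otimes>\<^sub>M training_sets Z n)
       {(S, S'). card {i \<in> {..<n}. S i \<noteq> S' i} \<le> 1}"

text \<open>
  A random pair of training sets that differ in at most one sample is given by its law \<open>P\<close> on the
  neighbouring pairs (a deterministic pair by a point mass), and its independence of the internal
  randomness \<open>R\<close> of the algorithm by the product measure. The expectation of the nonnegative norm is
  taken in \<open>[0, \<infinity>]\<close>, so that the supremum over the inputs \<open>X\<close> always exists. The condition
  \<open>0 \<le> \<epsilon>\<close> is needed since \<^const>\<open>ennreal\<close> sends negative reals to \<open>0\<close>.
\<close>

definition uniformly_stable ::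
  "'z measure \<Rightarrow> nat \<Rightarrow> 'r measure \<Rightarrow> ((nat \<Rightarrow> 'z) \<Rightarrow> 'r \<Rightarrow> 'p) \<Rightarrow>
    ('p \<Rightarrow> real ^ 'd \<Rightarrow> real ^ 'c) \<Rightarrow> (real ^ 'd) set \<Rightarrow>
    ((real ^ 'd \<Rightarrow> real ^ 'c) \<Rightarrow> real ^ 'd \<Rightarrow> real ^ 'd) \<Rightarrow> real \<Rightarrow> bool" where
  "uniformly_stable Z n R A f X I \<epsilon> \<longleftrightarrow>
     0 \<le> \<epsilon> \<and>
     (\<forall>P. prob_space P \<and> sets P = sets (neighbouring_pairs Z n) \<longrightarrow>
        (SUP x\<in>X. \<integral>\<^sup>+ ((S, S'), r).
           ennreal (norm (I (f (A S r)) x - I (f (A S' r)) x)) \<partial>(P \<Otimes>\<^sub>M R))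
        \<le> ennreal \<epsilon>)"

end

theory Submission imports Defs begin

text \<open>The matrix \<open>kappa G\<close> of a partition \<open>G\<close> is the orthogonal projection onto the vectors that
  are constant on the blocks of \<open>G\<close>, so it does not increase the Euclidean norm. It does not depend
  on the network, so it is the same linear map for both trained networks, and the difference of the
  grouped gradients is pointwise at most that of the plain ones: \<open>\<epsilon>' = \<epsilon>\<close> works.\<close>

text \<open>Disjointness of the blocks makes \<open>K\<close> the only block that contains
  \<open>i\<close>, which resolves both the existential and the \<open>THE\<close> in
  \<open>kappa\<close>.\<close>

lemma kappa_in_block:
  assumes "partition_on UNIV G" "K \<in> G" "i \<in> K"
  shows "kappa G $ i $ j = (if j \<in> K then 1 / real (card K) else 0)"
proof -
  have uniq: "L = K" if "L \<in> G" "i \<in> L" for L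
    using disjointD[OF partition_onD2[OF assms(1)] that(1) assms(2)] that(2) assms(3) by blast
  show ?thesis
  proof (cases "j \<in> K")
    case True
    have "(THE L. L \<in> G \<and> i \<in> L \<and> j \<in> L) = K"
    proof (rule the_equality)
      show "K \<in> G \<and> i \<in> K \<and> j \<in> K"
        using assms True by blast
    qed (use uniq in blast)
    moreover have "\<exists>L\<in>G. i \<in> L \<and> j \<in> L"
      using assms True by blast
    ultimately show ?thesis
      using True by (simp add: kappa_def)
  next
    case False
    with uniq have "\<not> (\<exists>L\<in>G. i \<in> L \<and> j \<in> L)" by blast
    with False show ?thesis by (auto simp: kappa_def)
  qed
qed

lemma kappa_symmetric: "transpose (kappa G) = kappa G"
  by (auto simp: transpose_def kappa_def vec_eq_iff conj_commute)

lemma kappa_idempotent: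
  assumes "partition_on UNIV G"
  shows "kappa G ** kappa G = kappa G"
proof -
  have "(\<Sum>k\<in>UNIV. kappa G $ i $ k * kappa G $ k $ j) = kappa G $ i $ j" for i j
  proof -
    obtain K where K: "K \<in> G" "i \<in> K"
      using assms by (auto simp: partition_on_def)
    \<comment> \<open>Rows of \<open>kappa G\<close> with index in the same block coincide: for
      \<open>k\<close> in \<open>K\<close> the second factor is already entry (i, j), and outside
      \<open>K\<close> the first factor vanishes.\<close>
    have "kappa G $ i $ k * kappa G $ k $ j
        = (if k \<in> K then kappa G $ i $ j / real (card K) else 0)" for k
      using kappa_in_block[OF assms K(1)] K(2) by auto
    then have "(\<Sum>k\<in>UNIV. kappa G $ i $ k * kappa G $ k $ j)
        = (\<Sum>k\<in>K. kappa G $ i $ j / real (card K))"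
      by (simp add: sum.If_cases)
    also have "\<dots> = kappa G $ i $ j"
      \<comment> \<open>The sum has \<open>card K\<close> equal terms; \<open>K\<close> is finite
        and contains \<open>i\<close>, so the division cancels.\<close>
      using K by (auto simp: card_gt_0_iff)
    finally show ?thesis .
  qed
  then show ?thesis
    by (simp add: matrix_matrix_mult_def vec_eq_iff)
qed

text \<open>By symmetry and idempotence, <Mv, Mv> = <v, MMv> = <v, Mv>; Cauchy-Schwarz then allows
  cancelling one factor |Mv|.\<close>

lemma norm_symmetric_idempotent_le:
  fixes M :: "real ^ 'n ^ 'n"
  assumes "transpose M = M" "M ** M = M"
  shows "norm (M *v v) \<le> norm v"
proof -
  have "v v* M = M *v v"
    using transpose_matrix_vector[of M v] unfolding assms(1) by (rule sym)
  then have "(norm (M *v v))\<^sup>2 = v \<bullet> (M *v v)"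
    using dot_lmul_matrix[of v M "M *v v"] assms(2)
    unfolding power2_norm_eq_inner by (simp add: matrix_vector_mul_assoc)
  also have "\<dots> \<le> norm v * norm (M *v v)"
    by (rule norm_cauchy_schwarz)
  finally show ?thesis
    \<comment> \<open>The cancellation requires Mv to be nonzero; otherwise the bound is
      trivial.\<close>
    by (cases "M *v v = 0") (auto simp: power2_eq_square)
qed

lemma norm_grouped_SG_diff_le:
  assumes "partition_on UNIV (grp x)"
  shows "norm (grouped_SG grp pred g x - grouped_SG grp pred h x)
    \<le> norm (SG pred g x - SG pred h x)"
  unfolding grouped_SG_def matrix_vector_mult_diff_distrib[symmetric]
  by (intro norm_symmetric_idempotent_le kappa_symmetric kappa_idempotent assms)

text \<open>Integral and supremum are monotone, so a pointwise bound passes through both for every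
  law \<open>P\<close>. It is asked for only at inputs in \<open>X\<close>, where the grouping is
  known to be a partition.\<close>

lemma uniformly_stable_mono:
  assumes "uniformly_stable Z n R A f X I \<epsilon>"
    and "\<And>x g h. x \<in> X \<Longrightarrow> norm (J g x - J h x) \<le> norm (I g x - I h x)"
  shows "uniformly_stable Z n R A f X J \<epsilon>"
proof -
  have "(SUP x\<in>X. \<integral>\<^sup>+ ((S, S'), r). ennreal (norm (J (f (A S r)) x - J (f (A S' r)) x)) \<partial>(P \<Otimes>\<^sub>M R))
      \<le> (SUP x\<in>X. \<integral>\<^sup>+ ((S, S'), r). ennreal (norm (I (f (A S r)) x - I (f (A S' r)) x)) \<partial>(P \<Otimes>\<^sub>M R))"
    for P
    by (rule SUP_subset_mono[OF order.refl], rule nn_integral_mono)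
      (simp add: assms(2) ennreal_leI split_beta)
  with assms(1) show ?thesis
    unfolding uniformly_stable_def by (meson order.trans)
qed

theorem proposition3:
  fixes f :: "'p \<Rightarrow> real ^ 'd \<Rightarrow> real ^ 'c"
    and \<Theta> :: "'p set"
    and X :: "(real ^ 'd) set"
    and Z :: "'z measure"
    and n :: nat
    and R :: "'r measure"
    and A :: "(nat \<Rightarrow> 'z) \<Rightarrow> 'r \<Rightarrow> 'p"
    and pred :: "real ^ 'c \<Rightarrow> 'c"
    and grp :: "real ^ 'd \<Rightarrow> 'd set set"
    and p :: nat
    and \<epsilon> :: real
  assumes "prob_space R"
    and "label_rule pred"
    and "\<And>S r. S \<in> space (training_sets Z n) \<Longrightarrow> r \<in> space R \<Longrightarrow> A S r \<in> \<Theta>"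
    and "\<And>\<theta> x. \<theta> \<in> \<Theta> \<Longrightarrow> x \<in> X \<Longrightarrow> f \<theta> differentiable (at x)"
    and "\<And>x. x \<in> X \<Longrightarrow>
           (\<lambda>(S, r). SG pred (f (A S r)) x) \<in> borel_measurable (training_sets Z n \<Otimes>\<^sub>M R)"
    and "\<And>x. x \<in> X \<Longrightarrow> partition_on UNIV (grp x) \<and> card (grp x) = p"
    and "uniformly_stable Z n R A f X (SG pred) \<epsilon>"
  shows "\<exists>\<epsilon>'\<le>\<epsilon>. uniformly_stable Z n R A f X (grouped_SG grp pred) \<epsilon>'"
proof (intro exI conjI)
  show "uniformly_stable Z n R A f X (grouped_SG grp pred) \<epsilon>"
    using assms(7)
    by (rule uniformly_stable_mono) (simp add: norm_grouped_SG_diff_le assms(6))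
qed simp

end
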